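(* Let $\mathbb{F}$ be an arbitrary field, let $k\ge1$ be an integer, let $\overline{E}=(E_1,\dots,E_k)\in(\mathbb{Z}_{\ge1})^k$ and $\overline{m}=(m_1,\dots,m_k)\in(\mathbb{Z}_{\ge2})^k$, and let $A=SV(\overline{E},\overline{m})$ be the Segre-Veronese algebra over $\mathbb{F}$ with degree sequence $\overline{E}$. Let $D:=\sum_{i=1}^kE_i$. Then $P^{(D(r-1)+1)}\subseteq P^r$ for all integers $r>0$ and all monomial prime ideals $P$ of $A$.
   Context: For integers $E\ge1$ and $m\ge2$, the Veronese ring $V_{E,m}$ is the $\mathbb{F}$-subalgebra of a polynomial ring $\mathbb{F}[x_1,\dots,x_m]$ generated by all monomials of degree $E$; it is standard graded, with these monomials in degree one. For standard graded $\mathbb{F}$-algebras $A_i=\mathbb{F}[a_{i,1},\dots,a_{i,b_i}]$ ($1\le i\le k$), given by degree one algebra generators, the Segre product $(\#_{\mathbb{F}})_{i=1}^kA_i$ is the $\mathbb{F}$-subalgebra of $A_1\otimes_{\mathbb{F}}\cdots\otimes_{\mathbb{F}}A_k$ generated by all $k$-fold products $a_{1,j_1}\cdots a_{k,j_k}$ (one generator from each $A_i$). The Segre-Veronese algebra is $SV(\overline{E},\overline{m})=(\#_{\mathbb{F}})_{i=1}^kV_{E_i,m_i}$. Equivalently, it is the $\mathbb{F}$-subalgebra of the polynomial ring $\mathbb{F}[x_{i,j} : 1\le i\le k,\ 1\le j\le m_i]$ generated by all products $\mu_1\cdots\mu_k$ where $\mu_i$ is a monomial of degree $E_i$ in $x_{i,1},\dots,x_{i,m_i}$.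 It is a normal toric (semigroup) algebra with $\mathbb{F}$-basis the monomials in the $x_{i,j}$ that it contains; an ideal of it is monomial if it is generated by a subset of these monomials. For a prime ideal $P$ of a Noetherian domain $R$ and an integer $a\ge1$, the symbolic power is $P^{(a)}=P^aR_P\cap R=\{f\in R : uf\in P^a\text{ for some }u\in R\setminus P\}$. *)

theory Defs
  imports "HOL-Library.Poly_Mapping" "HOL-Algebra.Algebra" "HOL-Algebra.Algebraic_Closure_Type"
begin

text \<open>Polynomials with coefficients in \<open>'a\<close> in the variables \<open>x\<^sub>i\<^sub>,\<^sub>j\<close>: the key of
  \<open>x\<^sub>i\<^sub>,\<^sub>j\<close> is \<open>(i, j)\<close>, a monomial is its finitely supported exponent function. All pairs
  of naturals are available as variables; each algebra below involves only finitely many.\<close>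

type_synonym 'a xpoly = "((nat \<times> nat) \<Rightarrow>\<^sub>0 nat) \<Rightarrow>\<^sub>0 'a"

definition monomial :: "((nat \<times> nat) \<Rightarrow>\<^sub>0 nat) \<Rightarrow> 'a::field xpoly"
  where "monomial t = Poly_Mapping.single t 1"

definition scalar :: "'a::field \<Rightarrow> 'a xpoly"
  where "scalar c = Poly_Mapping.single 0 c"

text \<open>The \<open>'a\<close>-subalgebra generated by \<open>G\<close> is the subring generated by \<open>G\<close> and the scalars.\<close>

definition generated_subalgebra :: "'a::field xpoly set \<Rightarrow> 'a xpoly ring"
  where "generated_subalgebra G =
    ring_of_type_algebra \<lparr> carrier := generate_ring ring_of_type_algebra (range scalar \<union> G) \<rparr>"

text \<open>The degree one generators of the Veronese ring \<open>V\<^bsub>e,n\<^esub>\<close>, realised in the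
  \<open>i\<close>-th block of variables \<open>x\<^sub>i\<^sub>,\<^sub>1, \<dots>, x\<^sub>i\<^sub>,\<^sub>n\<close>.\<close>

definition veronese_generators :: "nat \<Rightarrow> nat \<Rightarrow> nat \<Rightarrow> 'a::field xpoly set"
  where "veronese_generators i e n =
    {monomial t | t. Poly_Mapping.keys t \<subseteq> {i} \<times> {1..n} \<and>
                     (\<Sum>j = 1..n. Poly_Mapping.lookup t (i, j)) = e}"

text \<open>The tensor product of polynomial rings is the polynomial ring in the disjoint union of the
  blocks of variables, so the Segre product of the Veronese rings \<open>V\<^bsub>E i,m i\<^esub>\<close> is the
  subalgebra generated by the products of one generator from each block.\<close>

definition segre_veronese :: "nat \<Rightarrow> (nat \<Rightarrow> nat) \<Rightarrow> (nat \<Rightarrow> nat) \<Rightarrow> 'a::field xpoly ring"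
  where "segre_veronese k E m =
    generated_subalgebra {\<Prod>i = 1..k. \<mu> i | \<mu>. \<forall>i\<in>{1..k}. \<mu> i \<in> veronese_generators i (E i) (m i)}"

definition monomial_ideal :: "'a::field xpoly set \<Rightarrow> 'a xpoly ring \<Rightarrow> bool"
  where "monomial_ideal I R \<longleftrightarrow> (\<exists>S \<subseteq> range monomial \<inter> carrier R. I = genideal R S)"

definition ideal_power :: "('b, 'c) ring_scheme \<Rightarrow> 'b set \<Rightarrow> nat \<Rightarrow> 'b set"
  where "ideal_power R I n = I [^]\<^bsub>ideals_set R\<^esub> n"

definition symbolic_power :: "('b, 'c) ring_scheme \<Rightarrow> 'b set \<Rightarrow> nat \<Rightarrow> 'b set"
  where "symbolic_power R P a =
    {f \<in> carrier R. \<exists>u \<in> carrier R - P. u \<otimes>\<^bsub>R\<^esub> f \<in> ideal_power R P a}"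

lemma cring_generated_subalgebra: "cring (generated_subalgebra G)"
proof -
  interpret cring "ring_of_type_algebra :: 'a xpoly ring"
    by (rule cring_from_type_algebra)
  have "subring (generate_ring ring_of_type_algebra (range scalar \<union> G))
          (ring_of_type_algebra :: 'a xpoly ring)"
    by (rule generate_ring_is_subring) (simp add: ring_of_type_algebra_def)
  then show ?thesis
    unfolding generated_subalgebra_def
    using subcring_iff subcringI' subringE(1) by blast
qed

end

theory Submission
  imports Defs "HOL-Library.Product_Lexorder"
begin

text \<open>A monomial prime \<open>P\<close> consists of the elements all of whose monomials involve a variable of
  some fixed set \<open>Q\<close>, namely the variables dividing no generator outside \<open>P\<close>. Let \<open>w\<close> be the total
  degree in \<open>Q\<close>. Monomials of elements of \<open>P\<^sup>a\<close> have \<open>w \<ge> a\<close>, and by comparing lowest forms so do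
  those of \<open>P\<^bsup>(a)\<^esup>\<close>. Conversely, each generator has \<open>w \<le> D\<close>, so in a product of generators with
  \<open>w \<ge> D(r - 1) + 1\<close> at least \<open>r\<close> factors have \<open>w \<ge> 1\<close>, that is, lie in \<open>P\<close>.\<close>

section \<open>Lowest forms with respect to a weight\<close>

lemma sum_single_lookup:
  fixes f :: "'b \<Rightarrow>\<^sub>0 'a::comm_monoid_add"
  shows "(\<Sum>t\<in>Poly_Mapping.keys f. Poly_Mapping.single t (Poly_Mapping.lookup f t)) = f"
  by (rule poly_mapping_eqI)
    (auto simp: lookup_sum lookup_single when_def sum.delta in_keys_iff)

text \<open>The coefficients form a domain and the exponents are linearly ordered, so the product of
  the two lowest forms is nonzero. All other contributions to \<open>f * g\<close> have larger
  weight and cannot cancel it. For exponents of \<open>xpoly\<close> the order rests on the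
  lexicographic order of the pairs \<open>(i, j)\<close>; it need not be related to
  \<open>w\<close>.\<close>

lemma keys_mult_lowest:
  fixes f g :: "('b::{ordered_cancel_comm_monoid_add,linorder}) \<Rightarrow>\<^sub>0 'a::idom"
    and w :: "'b \<Rightarrow> nat"
  assumes add: "\<And>s t. w (s + t) = w s + w t"
    and f: "s \<in> Poly_Mapping.keys f" "\<And>t. t \<in> Poly_Mapping.keys f \<Longrightarrow> w s \<le> w t"
    and g: "s' \<in> Poly_Mapping.keys g" "\<And>t. t \<in> Poly_Mapping.keys g \<Longrightarrow> w s' \<le> w t"
  obtains t where "t \<in> Poly_Mapping.keys (f * g)" "w t = w s + w s'"
proof -
  \<comment> \<open>\<open>part c h\<close> keeps the terms of \<open>h\<close> of weight
    \<open>c\<close>, so \<open>f0\<close> and \<open>g0\<close> are the lowest forms,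
    \<open>f1\<close> and \<open>g1\<close> the remainders.\<close>
  define part where "part c = Poly_Mapping.mapp (\<lambda>t (x :: 'a). x when w t = c)" for c
  have lookup_part: "Poly_Mapping.lookup (part c h) t = (Poly_Mapping.lookup h t when w t = c)"
    for c t and h :: "'b \<Rightarrow>\<^sub>0 'a"
    by (auto simp: part_def lookup_mapp when_def in_keys_iff)
  define f0 g0 f1 g1 where "f0 = part (w s) f" and "g0 = part (w s') g"
    and "f1 = f - f0" and "g1 = g - g0"
  have f0k: "w t = w s" if "t \<in> Poly_Mapping.keys f0" for t
    using that by (auto simp: f0_def in_keys_iff lookup_part when_def split: if_splits)
  have g0k: "w t = w s'" if "t \<in> Poly_Mapping.keys g0" for t
    using that by (auto simp: g0_def in_keys_iff lookup_part when_def split: if_splits)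
  have f1k: "w s < w t" if "t \<in> Poly_Mapping.keys f1" for t
  proof -
    have "t \<in> Poly_Mapping.keys f" "w t \<noteq> w s"
      using that by (auto simp: f1_def f0_def in_keys_iff lookup_minus lookup_part when_def split: if_splits)
    then show ?thesis using f(2)[of t] by simp
  qed
  have g1k: "w s' < w t" if "t \<in> Poly_Mapping.keys g1" for t
  proof -
    have "t \<in> Poly_Mapping.keys g" "w t \<noteq> w s'"
      using that by (auto simp: g1_def g0_def in_keys_iff lookup_minus lookup_part when_def split: if_splits)
    then show ?thesis using g(2)[of t] by simp
  qed
  have gk: "w s' \<le> w t" if "t \<in> Poly_Mapping.keys g" for t using g(2) that by blast
  have "Poly_Mapping.lookup f0 s \<noteq> 0" "Poly_Mapping.lookup g0 s' \<noteq> 0"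
    using f(1) g(1) by (simp_all add: f0_def g0_def lookup_part in_keys_iff)
  then have "f0 \<noteq> 0" "g0 \<noteq> 0" by auto
  then have "f0 * g0 \<noteq> 0" by simp
  then obtain t where t: "t \<in> Poly_Mapping.keys (f0 * g0)"
    by (metis keys_eq_empty all_not_in_conv)
  have wt: "w t = w s + w s'"
    using keys_mult[of f0 g0] t f0k g0k add by fastforce
  have "t \<notin> Poly_Mapping.keys (f0 * g1)"
  proof
    assume "t \<in> Poly_Mapping.keys (f0 * g1)"
    then obtain a b where "t = a + b" "a \<in> Poly_Mapping.keys f0" "b \<in> Poly_Mapping.keys g1"
      using keys_mult[of f0 g1] by blast
    then show False using f0k[of a] g1k[of b] wt add[of a b] by simp
  qed
  moreover have "t \<notin> Poly_Mapping.keys (f1 * g)"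
  proof
    assume "t \<in> Poly_Mapping.keys (f1 * g)"
    then obtain a b where "t = a + b" "a \<in> Poly_Mapping.keys f1" "b \<in> Poly_Mapping.keys g"
      using keys_mult[of f1 g] by blast
    then show False using f1k[of a] gk[of b] wt add[of a b] by simp
  qed
  \<comment> \<open>Only the first of these products can have terms of weight
    \<open>w s + w s'\<close>.\<close>
  moreover have "f * g = f0 * g0 + f0 * g1 + f1 * g"
    by (simp add: f1_def g1_def algebra_simps)
  ultimately have "t \<in> Poly_Mapping.keys (f * g)"
    using t by (simp add: in_keys_iff lookup_add)
  then show thesis using wt by (rule that)
qed

section \<open>Algebras generated by monomials\<close>

lemma monomial_zero: "monomial 0 = 1"
  by (simp add: monomial_def)

lemma monomial_add: "monomial (s + t) = monomial s * monomial t"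
  by (simp add: monomial_def mult_single)

lemma monomial_sum: "monomial (\<Sum>i\<in>I. t i) = (\<Prod>i\<in>I. monomial (t i))"
  by (induction I rule: infinite_finite_induct) (auto simp: monomial_zero monomial_add)

text \<open>The submonoid generated by \<open>G\<close>, built by prepending one generator at a
  time, so that inductions peel off single factors and can count those in \<open>P\<close>.\<close>

inductive_set exponent_monoid :: "'b::monoid_add set \<Rightarrow> 'b set" for G where
  zero: "0 \<in> exponent_monoid G"
| add: "g \<in> G \<Longrightarrow> t \<in> exponent_monoid G \<Longrightarrow> g + t \<in> exponent_monoid G"

lemma exponent_monoid_incl: "g \<in> G \<Longrightarrow> g \<in> exponent_monoid G"
  using exponent_monoid.add[OF _ exponent_monoid.zero] by fastforce

lemma exponent_monoid_add:
  "s \<in> exponent_monoid G \<Longrightarrow> t \<in> exponent_monoid G \<Longrightarrow> s + t \<in> exponent_monoid G"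
  by (induction s rule: exponent_monoid.induct) (auto simp: add.assoc intro: exponent_monoid.intros)

lemma generated_subalgebra_sel [simp]:
  "f \<oplus>\<^bsub>generated_subalgebra G\<^esub> g = f + g"
  "f \<otimes>\<^bsub>generated_subalgebra G\<^esub> g = f * g"
  "\<zero>\<^bsub>generated_subalgebra G\<^esub> = 0"
  "\<one>\<^bsub>generated_subalgebra G\<^esub> = 1"
  by (simp_all add: generated_subalgebra_def ring_of_type_algebra_def)

lemma ring_of_type_algebra_sel:
  "f \<oplus>\<^bsub>ring_of_type_algebra\<^esub> g = f + g"
  "f \<otimes>\<^bsub>ring_of_type_algebra\<^esub> g = f * g"
  "\<one>\<^bsub>ring_of_type_algebra\<^esub> = 1"
  by (simp_all add: ring_of_type_algebra_def)

lemma ring_of_type_algebra_minus: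
  "\<ominus>\<^bsub>ring_of_type_algebra\<^esub> f = - (f :: 'a::comm_ring_1)"
proof -
  interpret ring "ring_of_type_algebra :: 'a ring" by (rule ring_from_type_algebra)
  have "- f \<oplus>\<^bsub>ring_of_type_algebra\<^esub> f = \<zero>\<^bsub>ring_of_type_algebra\<^esub>"
    by (simp add: ring_of_type_algebra_def)
  then show ?thesis
    by (intro minus_equality) (auto simp: ring_of_type_algebra_def)
qed

text \<open>Ring operations create no monomials outside the submonoid; conversely an element is a
  combination of its monomials, each a product of generators.\<close>

lemma carrier_generated_subalgebra:
  "carrier (generated_subalgebra (monomial ` G)) =
    {f :: 'a::field xpoly. Poly_Mapping.keys f \<subseteq> exponent_monoid G}"
proof -
  let ?R = "ring_of_type_algebra :: 'a xpoly ring"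
  let ?C = "generate_ring ?R (range scalar \<union> monomial ` G)"
  have "Poly_Mapping.keys f \<subseteq> exponent_monoid G" if "f \<in> ?C" for f
    using that
  proof induction
    case one
    then show ?case by (auto simp: ring_of_type_algebra_sel exponent_monoid.zero)
  next
    case (incl h)
    then show ?case
      by (auto simp: scalar_def monomial_def exponent_monoid_incl exponent_monoid.zero split: if_splits)
  next
    case (a_inv h)
    then show ?case by (auto simp: ring_of_type_algebra_minus in_keys_iff)
  next
    case (eng_add h1 h2)
    then show ?case
      using Poly_Mapping.keys_add[of h1 h2] unfolding ring_of_type_algebra_sel by blast
  next
    case (eng_mult h1 h2)
    then show ?case
      using keys_mult[of h1 h2] exponent_monoid_add unfolding ring_of_type_algebra_sel by blast
  qed
  moreover have "f \<in> ?C" if f: "Poly_Mapping.keys f \<subseteq> exponent_monoid G" for f :: "'a xpoly"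
  proof -
    have add: "a + b \<in> ?C" if "a \<in> ?C" "b \<in> ?C" for a b
      using generate_ring.eng_add[OF that] by (simp add: ring_of_type_algebra_sel)
    have mult: "a * b \<in> ?C" if "a \<in> ?C" "b \<in> ?C" for a b
      using generate_ring.eng_mult[OF that] by (simp add: ring_of_type_algebra_sel)
    have scalar: "scalar c \<in> ?C" for c by (auto intro: generate_ring.incl)
    have mono: "monomial t \<in> ?C" if "t \<in> exponent_monoid G" for t
      using that
    proof induction
      case zero
      then show ?case using scalar[of 1] by (simp add: scalar_def monomial_def)
    next
      case (add g t)
      then show ?case by (auto simp: monomial_add intro!: mult intro: generate_ring.incl)
    qed
    have "(\<Sum>t\<in>K. Poly_Mapping.single t (Poly_Mapping.lookup f t)) \<in> ?C"
      if "finite K" "K \<subseteq> exponent_monoid G" for K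
      using that
    proof (induction K rule: finite_induct)
      case empty
      then show ?case using scalar[of 0] by (simp add: scalar_def)
    next
      case (insert t K)
      have "Poly_Mapping.single t (Poly_Mapping.lookup f t) = scalar (Poly_Mapping.lookup f t) * monomial t"
        by (simp add: scalar_def monomial_def mult_single)
      then show ?case using insert by (auto intro!: add mult scalar mono)
    qed
    from this[OF _ f] show "f \<in> ?C" by (simp add: sum_single_lookup)
  qed
  ultimately show ?thesis by (auto simp: generated_subalgebra_def)
qed

section \<open>Monomial primes\<close>

lemma (in ring) ideal_power_ideal:
  assumes "ideal I R"
  shows "ideal (ideal_power R I n) R"
  by (induction n)
    (simp_all add: ideal_power_def ideals_set_def oneideal nat_pow_def ideal_prod_is_ideal assms)

lemma ideal_power_0: "ideal_power R I 0 = carrier R"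
  by (simp add: ideal_power_def ideals_set_def nat_pow_def)

lemma ideal_power_Suc: "ideal_power R I (Suc n) = ideal_prod R (ideal_power R I n) I"
  by (simp add: ideal_power_def ideals_set_def nat_pow_def)

locale monomial_prime =
  fixes G :: "(nat \<times> nat \<Rightarrow>\<^sub>0 nat) set" and A :: "'a::field xpoly ring" and P :: "'a xpoly set"
  assumes A: "A = generated_subalgebra (monomial ` G)"
    and prime: "primeideal P A"
    and monomial: "monomial_ideal P A"
begin

sublocale primeideal P A by (rule prime)

lemma sel [simp]:
  "f \<oplus>\<^bsub>A\<^esub> g = f + g" "f \<otimes>\<^bsub>A\<^esub> g = f * g" "\<zero>\<^bsub>A\<^esub> = 0" "\<one>\<^bsub>A\<^esub> = 1"
  by (simp_all add: A)

lemma mem_carrier_iff: "f \<in> carrier A \<longleftrightarrow> Poly_Mapping.keys f \<subseteq> exponent_monoid G"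
  by (simp add: A carrier_generated_subalgebra)

lemma monomial_in_carrier: "t \<in> exponent_monoid G \<Longrightarrow> monomial t \<in> carrier A"
  by (simp add: mem_carrier_iff monomial_def)

text \<open>Scalars have exponent \<open>0\<close>, hence lie in \<open>A\<close>, and
  \<open>f\<close> is the sum of scalar multiples of its monomials.\<close>

lemma mem_ideal_if_keys:
  assumes "ideal I A" "\<And>t. t \<in> Poly_Mapping.keys f \<Longrightarrow> monomial t \<in> I"
  shows "f \<in> I"
proof -
  interpret I: ideal I A by fact
  have "(\<Sum>t\<in>K. Poly_Mapping.single t (Poly_Mapping.lookup f t)) \<in> I"
    if "finite K" "K \<subseteq> Poly_Mapping.keys f" for K
    using that
  proof (induction K rule: finite_induct)
    case empty
    then show ?case using I.zero_closed by simp
  next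
    case (insert t K)
    have "scalar (Poly_Mapping.lookup f t) \<in> carrier A"
      by (simp add: mem_carrier_iff scalar_def exponent_monoid.zero)
    from I.I_l_closed[OF assms(2) this, of t] insert(4)
    have "Poly_Mapping.single t (Poly_Mapping.lookup f t) \<in> I"
      by (simp add: scalar_def monomial_def mult_single)
    from I.a_closed[OF this insert(3)] insert show ?case by simp
  qed
  from this[of "Poly_Mapping.keys f"] show ?thesis by (simp add: sum_single_lookup)
qed

text \<open>The elements whose monomials all lie in \<open>P\<close> form an ideal \<open>J\<close>
  containing the monomial generators of \<open>P\<close>, so \<open>P\<close> is contained in
  \<open>J\<close> by minimality.\<close>

lemma monomial_in_P_if_key:
  assumes "f \<in> P" "t \<in> Poly_Mapping.keys f"
  shows "monomial t \<in> P"
proof -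
  define J where "J = {f \<in> carrier A. \<forall>t\<in>Poly_Mapping.keys f. monomial t \<in> P}"
  obtain S where S: "S \<subseteq> range monomial \<inter> carrier A" "P = genideal A S"
    using monomial by (auto simp: monomial_ideal_def)
  have J0: "0 \<in> J" by (simp add: J_def mem_carrier_iff)
  have Jadd: "f + g \<in> J" if "f \<in> J" "g \<in> J" for f g
    using that Poly_Mapping.keys_add[of f g] by (auto simp: J_def mem_carrier_iff)
  have Jmult: "g * f \<in> J" if f: "f \<in> J" and g: "g \<in> carrier A" for f g
  proof -
    have "monomial t \<in> P" if t: "t \<in> Poly_Mapping.keys (g * f)" for t
    proof -
      obtain a b where ab: "t = a + b" "a \<in> Poly_Mapping.keys g" "b \<in> Poly_Mapping.keys f"
        using t keys_mult[of g f] by blast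
      have "monomial a \<in> carrier A" "monomial b \<in> P"
        using ab f g by (auto simp: J_def mem_carrier_iff monomial_def)
      then show ?thesis using I_l_closed ab by (auto simp: monomial_add)
    qed
    moreover have "g * f \<in> carrier A" using f g m_closed[of g f] by (simp add: J_def)
    ultimately show ?thesis by (simp add: J_def)
  qed
  have "ideal J A"
  proof (rule idealI)
    show "ring A" by (rule ring_axioms)
    show "subgroup J (add_monoid A)"
    proof (rule add.subgroupI)
      show "J \<subseteq> carrier A" by (auto simp: J_def)
      show "J \<noteq> {}" using J0 by auto
      show "\<ominus>\<^bsub>A\<^esub> f \<in> J" if "f \<in> J" for f
      proof -
        have f: "f \<in> carrier A" using that by (simp add: J_def)
        have "\<ominus>\<^bsub>A\<^esub> f = (\<ominus>\<^bsub>A\<^esub> \<one>\<^bsub>A\<^esub>) * f"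
          using l_minus[OF one_closed f] f by simp
        then show ?thesis using Jmult[OF that a_inv_closed[OF one_closed]] by simp
      qed
      show "f \<oplus>\<^bsub>A\<^esub> g \<in> J" if "f \<in> J" "g \<in> J" for f g
        using Jadd[OF that] by simp
    qed
    show "x \<otimes>\<^bsub>A\<^esub> a \<in> J" if "a \<in> J" "x \<in> carrier A" for a x
      using Jmult[OF that] by simp
    show "a \<otimes>\<^bsub>A\<^esub> x \<in> J" if "a \<in> J" "x \<in> carrier A" for a x
      using Jmult[OF that] by (simp add: mult.commute)
  qed
  moreover have "S \<subseteq> J"
  proof
    fix f assume f: "f \<in> S"
    then have "f \<in> P" using S genideal_self[of S] by auto
    then show "f \<in> J" using f S by (auto simp: J_def monomial_def)
  qed
  ultimately have "P \<subseteq> J" using S(2) genideal_minimal by simp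
  then show ?thesis using assms by (auto simp: J_def)
qed

lemma monomial_add_in_P_iff:
  assumes "s \<in> exponent_monoid G" "t \<in> exponent_monoid G"
  shows "monomial (s + t) \<in> P \<longleftrightarrow> monomial s \<in> P \<or> monomial t \<in> P"
  using assms I_prime[of "monomial s" "monomial t"] I_l_closed[of "monomial t" "monomial s"]
    I_r_closed[of "monomial s" "monomial t"] monomial_in_carrier
  by (auto simp: monomial_add)

lemma monomial_zero_notin_P: "monomial 0 \<notin> P"
proof
  assume "monomial 0 \<in> P"
  then have "\<one>\<^bsub>A\<^esub> \<in> P" by (simp add: monomial_zero)
  then show False using one_imp_carrier I_notcarr by blast
qed

end

section \<open>Weights that detect a monomial prime\<close>

locale weighted_monomial_prime = monomial_prime +
  fixes w :: "(nat \<times> nat \<Rightarrow>\<^sub>0 nat) \<Rightarrow> nat" and D :: nat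
  assumes w_add: "w (s + t) = w s + w t"
    and w_le: "g \<in> G \<Longrightarrow> w g \<le> D"
    and w_eq_0_iff: "g \<in> G \<Longrightarrow> w g = 0 \<longleftrightarrow> monomial g \<notin> P"
    and D_pos: "D > 0"
begin

lemma w_0 [simp]: "w 0 = 0"
  using w_add[of 0 0] by simp

text \<open>A sum of generators has weight \<open>0\<close> exactly when each summand has, and by
  primality avoids \<open>P\<close> exactly when each summand does.\<close>

lemma w_eq_0_iff_notin_P: "t \<in> exponent_monoid G \<Longrightarrow> w t = 0 \<longleftrightarrow> monomial t \<notin> P"
  by (induction rule: exponent_monoid.induct)
    (auto simp: monomial_zero_notin_P w_add w_eq_0_iff monomial_add_in_P_iff exponent_monoid_incl)

text \<open>Each factor from \<open>P\<close> has only monomials of positive weight, and adding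
  elements creates no new monomials.\<close>

lemma weight_ideal_power:
  "f \<in> ideal_power A P n \<Longrightarrow> t \<in> Poly_Mapping.keys f \<Longrightarrow> n \<le> w t"
proof (induction n arbitrary: f t)
  case (Suc n)
  from Suc.prems(1) have "f \<in> ideal_prod A (ideal_power A P n) P"
    by (simp add: ideal_power_Suc)
  then show ?case using Suc.prems(2)
  proof (induction arbitrary: t rule: ideal_prod.induct)
    case (prod i j)
    then obtain a b where ab: "t = a + b" "a \<in> Poly_Mapping.keys i" "b \<in> Poly_Mapping.keys j"
      using keys_mult[of i j] by auto
    have "b \<in> exponent_monoid G"
      using prod(2) ab(3) Icarr mem_carrier_iff by blast
    then have "w b \<noteq> 0"
      using w_eq_0_iff_notin_P monomial_in_P_if_key prod(2) ab(3) by blast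
    with Suc.IH[OF prod(1) ab(2)] show ?case by (simp add: ab(1) w_add)
  next
    case (sum s1 s2)
    then show ?case using Poly_Mapping.keys_add[of s1 s2] by auto
  qed
qed simp

text \<open>Some monomial of \<open>u\<close> has weight \<open>0\<close>, so the lowest weight in
  \<open>u * f\<close> is that of \<open>f\<close>, and \<open>u * f\<close> lies in the ordinary
  power.\<close>

lemma weight_symbolic_power:
  assumes "f \<in> symbolic_power A P n" "t \<in> Poly_Mapping.keys f"
  shows "n \<le> w t"
proof -
  obtain u where u: "u \<in> carrier A" "u \<notin> P" "u * f \<in> ideal_power A P n"
    using assms(1) by (auto simp: symbolic_power_def)
  \<comment> \<open>If all monomials of \<open>u\<close> were in \<open>P\<close>, so would be
    \<open>u\<close>. The weight of \<open>s\<close> is then \<open>0\<close>, the least value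
    possible.\<close>
  obtain s where s: "s \<in> Poly_Mapping.keys u" "monomial s \<notin> P"
    using mem_ideal_if_keys[OF ideal_axioms] u(2) by blast
  then have "w s = 0" using w_eq_0_iff_notin_P u(1) mem_carrier_iff by blast
  define t' where "t' = arg_min_on w (Poly_Mapping.keys f)"
  have "f \<noteq> 0" using assms(2) by auto
  then have t': "t' \<in> Poly_Mapping.keys f" "\<And>t. t \<in> Poly_Mapping.keys f \<Longrightarrow> w t' \<le> w t"
    using arg_min_if_finite(1)[of "Poly_Mapping.keys f" w]
      arg_min_least[of "Poly_Mapping.keys f" _ w] unfolding t'_def by auto
  obtain v where "v \<in> Poly_Mapping.keys (u * f)" "w v = w s + w t'"
    using keys_mult_lowest[OF w_add s(1) _ t'] \<open>w s = 0\<close> by auto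
  then show ?thesis using weight_ideal_power[OF u(3)] t'(2)[OF assms(2)] \<open>w s = 0\<close> by fastforce
qed

text \<open>For \<open>n > 0\<close> the inequality says \<open>D * (n - 1) < w t\<close>; this form
  avoids truncated subtraction and is trivial for \<open>n = 0\<close>. Peeling off a generator in
  \<open>P\<close> costs at most \<open>D\<close> of weight and yields one factor of the power; a
  generator outside \<open>P\<close> costs nothing and is absorbed by the ideal.\<close>

lemma monomial_in_ideal_power:
  "t \<in> exponent_monoid G \<Longrightarrow> D * n < w t + D \<Longrightarrow> monomial t \<in> ideal_power A P n"
proof (induction arbitrary: n rule: exponent_monoid.induct)
  case zero
  then have "n = 0" by simp
  then show ?case by (simp add: ideal_power_0 monomial_in_carrier exponent_monoid.zero)
next
  case (add g t n)
  interpret I: ideal "ideal_power A P n" A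
    by (rule ideal_power_ideal) (rule ideal_axioms)
  show ?case
  proof (cases "n = 0 \<or> w g = 0")
    case True
    \<comment> \<open>For \<open>n = 0\<close> this holds because \<open>D > 0\<close>; for
      \<open>w g = 0\<close> the bound is unchanged.\<close>
    then have "D * n < w t + D" using add.prems D_pos by (auto simp: w_add)
    from I.I_l_closed[OF add.IH[OF this] monomial_in_carrier[OF exponent_monoid_incl[OF add(1)]]]
    show ?thesis by (simp add: monomial_add)
  next
    case False
    then obtain n' where n: "n = Suc n'" by (cases n) auto
    have "monomial t \<in> ideal_power A P n'"
      using add.prems w_le[OF add(1)] by (intro add.IH) (simp add: n w_add)
    moreover have "monomial g \<in> P" using w_eq_0_iff[OF add(1)] False by simp
    ultimately have "monomial t \<otimes>\<^bsub>A\<^esub> monomial g \<in> ideal_power A P n"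
      unfolding n ideal_power_Suc by (rule ideal_prod.prod)
    then show ?thesis by (simp add: monomial_add mult.commute)
  qed
qed

lemma symbolic_power_subset:
  assumes "r > 0"
  shows "symbolic_power A P (D * (r - 1) + 1) \<subseteq> ideal_power A P r"
proof
  fix f assume f: "f \<in> symbolic_power A P (D * (r - 1) + 1)"
  show "f \<in> ideal_power A P r"
  proof (rule mem_ideal_if_keys)
    show "ideal (ideal_power A P r) A" by (rule ideal_power_ideal) (rule ideal_axioms)
    fix t assume t: "t \<in> Poly_Mapping.keys f"
    have "t \<in> exponent_monoid G" using f t by (auto simp: symbolic_power_def mem_carrier_iff)
    \<comment> \<open>As \<open>r > 0\<close>, this is just weight at least
      \<open>D * (r - 1) + 1\<close>.\<close>
    moreover have "D * r < w t + D"
      using weight_symbolic_power[OF f t] assms by (cases r) auto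
    ultimately show "monomial t \<in> ideal_power A P r" by (rule monomial_in_ideal_power)
  qed
qed

end

section \<open>Segre-Veronese exponents\<close>

text \<open>The condition on \<open>keys\<close> excludes the variables outside the \<open>k\<close>
  blocks, which the polynomial type also contains.\<close>

definition segre_veronese_exponents :: "nat \<Rightarrow> (nat \<Rightarrow> nat) \<Rightarrow> (nat \<Rightarrow> nat) \<Rightarrow> (nat \<times> nat \<Rightarrow>\<^sub>0 nat) set"
  where "segre_veronese_exponents k E m =
    {t. Poly_Mapping.keys t \<subseteq> (SIGMA i:{1..k}. {1..m i}) \<and>
        (\<forall>i\<in>{1..k}. (\<Sum>j = 1..m i. Poly_Mapping.lookup t (i, j)) = E i)}"

text \<open>Adding block exponents turns a family of Veronese monomials into one exponent;
  restricting an exponent to its blocks recovers such a family.\<close>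

lemma segre_veronese_eq:
  "segre_veronese k E m = generated_subalgebra (monomial ` segre_veronese_exponents k E m)"
proof -
  have "(\<Prod>i = 1..k. \<mu> i) \<in> monomial ` segre_veronese_exponents k E m"
    if \<mu>: "\<forall>i\<in>{1..k}. \<mu> i \<in> veronese_generators i (E i) (m i)" for \<mu> :: "nat \<Rightarrow> 'a xpoly"
  proof -
    have "\<forall>i\<in>{1..k}. \<exists>t. \<mu> i = monomial t \<and> Poly_Mapping.keys t \<subseteq> {i} \<times> {1..m i} \<and>
        (\<Sum>j = 1..m i. Poly_Mapping.lookup t (i, j)) = E i"
      using \<mu> by (auto simp: veronese_generators_def)
    from bchoice[OF this] obtain t where t: "\<And>i. i \<in> {1..k} \<Longrightarrow> \<mu> i = monomial (t i) \<and>
        Poly_Mapping.keys (t i) \<subseteq> {i} \<times> {1..m i} \<and>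
        (\<Sum>j = 1..m i. Poly_Mapping.lookup (t i) (i, j)) = E i"
      by blast
    have lookup: "Poly_Mapping.lookup (\<Sum>i = 1..k. t i) (i, j) = Poly_Mapping.lookup (t i) (i, j)"
      if "i \<in> {1..k}" for i j
    proof -
      have "Poly_Mapping.lookup (t l) (i, j) = 0" if "l \<in> {1..k} - {i}" for l
        using that t[of l] by (auto simp: in_keys_iff)
      then show ?thesis using that by (simp add: lookup_add lookup_sum sum.remove[of _ i])
    qed
    have "Poly_Mapping.keys (\<Sum>i = 1..k. t i) \<subseteq> (\<Union>i\<in>{1..k}. Poly_Mapping.keys (t i))"
      by (rule keys_sum)
    also have "\<dots> \<subseteq> (SIGMA i:{1..k}. {1..m i})" using t by fastforce
    finally have "(\<Sum>i = 1..k. t i) \<in> segre_veronese_exponents k E m"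
      using t by (simp add: segre_veronese_exponents_def lookup del: One_nat_def)
    moreover have "(\<Prod>i = 1..k. \<mu> i) = monomial (\<Sum>i = 1..k. t i)"
      using t by (simp add: monomial_sum)
    ultimately show ?thesis by blast
  qed
  moreover have "\<exists>\<mu>. monomial t = (\<Prod>i = 1..k. \<mu> i) \<and>
      (\<forall>i\<in>{1..k}. \<mu> i \<in> (veronese_generators i (E i) (m i) :: 'a xpoly set))"
    if t: "t \<in> segre_veronese_exponents k E m" for t
  proof -
    \<comment> \<open>\<open>b i\<close> is the restriction of \<open>t\<close> to block
      \<open>i\<close>.\<close>
    define b where "b i = Poly_Mapping.mapp (\<lambda>x e. e when fst x = i) t" for i
    have b: "Poly_Mapping.lookup (b i) x = (Poly_Mapping.lookup t x when fst x = i)" for i x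
      by (auto simp: b_def lookup_mapp when_def in_keys_iff)
    have "(\<Sum>i = 1..k. b i) = t"
    proof (rule poly_mapping_eqI)
      fix x
      show "Poly_Mapping.lookup (\<Sum>i = 1..k. b i) x = Poly_Mapping.lookup t x"
        using t by (cases x) (auto simp: lookup_sum b when_def segre_veronese_exponents_def in_keys_iff)
    qed
    moreover have "monomial (b i) \<in> veronese_generators i (E i) (m i)" if "i \<in> {1..k}" for i
    proof -
      have "Poly_Mapping.keys (b i) \<subseteq> Poly_Mapping.keys t \<inter> {i} \<times> UNIV"
        by (auto simp: in_keys_iff b when_def split: if_splits)
      then have "Poly_Mapping.keys (b i) \<subseteq> {i} \<times> {1..m i}"
        using t unfolding segre_veronese_exponents_def by blast
      moreover have "(\<Sum>j = 1..m i. Poly_Mapping.lookup (b i) (i, j)) = E i"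
        using t that by (simp add: b segre_veronese_exponents_def)
      ultimately show ?thesis by (auto simp: veronese_generators_def)
    qed
    ultimately show ?thesis by (metis monomial_sum)
  qed
  ultimately have "{\<Prod>i = 1..k. \<mu> i | \<mu>. \<forall>i\<in>{1..k}. \<mu> i \<in> veronese_generators i (E i) (m i)} =
      (monomial ` segre_veronese_exponents k E m :: 'a xpoly set)"
    by blast
  then show ?thesis by (simp add: segre_veronese_def)
qed

section \<open>Exchange of variables between generators\<close>

lemma segre_veronese_exponents_ex_less:
  assumes g: "g \<in> segre_veronese_exponents k E m" and h: "h \<in> segre_veronese_exponents k E m"
    and "g \<noteq> h"
  obtains i j j' where "i \<in> {1..k}" "j \<in> {1..m i}" "j' \<in> {1..m i}"
    "Poly_Mapping.lookup h (i, j) < Poly_Mapping.lookup g (i, j)"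
    "Poly_Mapping.lookup g (i, j') < Poly_Mapping.lookup h (i, j')"
proof -
  \<comment> \<open>Both exponents have total \<open>E i\<close> in block \<open>i\<close>, so an
    excess at one variable forces a deficit at another.\<close>
  have strict: "\<exists>j\<in>{1..m i}. Poly_Mapping.lookup a (i, j) < Poly_Mapping.lookup b (i, j)"
    if "a \<in> segre_veronese_exponents k E m" "b \<in> segre_veronese_exponents k E m" "i \<in> {1..k}"
      "j \<in> {1..m i}" "Poly_Mapping.lookup b (i, j) < Poly_Mapping.lookup a (i, j)" for a b i j
  proof (rule ccontr)
    assume "\<not> ?thesis"
    then have "(\<Sum>j = 1..m i. Poly_Mapping.lookup b (i, j)) < (\<Sum>j = 1..m i. Poly_Mapping.lookup a (i, j))"
      using that(4,5) by (intro sum_strict_mono_ex1) (auto simp: not_less)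
    then show False using that(1-3) by (simp add: segre_veronese_exponents_def)
  qed
  obtain i j where ij: "Poly_Mapping.lookup g (i, j) \<noteq> Poly_Mapping.lookup h (i, j)"
    using \<open>g \<noteq> h\<close> poly_mapping_eqI by (metis surj_pair)
  then have "(i, j) \<in> Poly_Mapping.keys g \<union> Poly_Mapping.keys h" by (auto simp: in_keys_iff)
  then have "i \<in> {1..k}" "j \<in> {1..m i}"
    using g h by (auto simp: segre_veronese_exponents_def)
  then show thesis
    using ij strict[OF g h] strict[OF h g] that by (meson linorder_neqE_nat)
qed

text \<open>Both variables lie in block \<open>i\<close>, so every block degree is
  preserved.\<close>

lemma segre_veronese_exponents_swap:
  assumes t: "t + Poly_Mapping.single (i, j) 1 \<in> segre_veronese_exponents k E m"
    and "i \<in> {1..k}" "j' \<in> {1..m i}" "j \<in> {1..m i}"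
  shows "t + Poly_Mapping.single (i, j') 1 \<in> segre_veronese_exponents k E m"
proof -
  have keys: "Poly_Mapping.keys (t + Poly_Mapping.single (i, j') 1) \<subseteq>
      Poly_Mapping.keys (t + Poly_Mapping.single (i, j) 1) \<union> {(i, j')}"
    by (auto simp: in_keys_iff lookup_add lookup_single when_def split: if_splits)
  have "(\<Sum>l = 1..m a. Poly_Mapping.lookup (t + Poly_Mapping.single (i, j') 1) (a, l)) =
      (\<Sum>l = 1..m a. Poly_Mapping.lookup (t + Poly_Mapping.single (i, j) 1) (a, l))" for a
    using assms(3,4)
    by (cases "a = i") (simp_all add: lookup_add lookup_single when_def sum.distrib)
  then show ?thesis using assms keys by (auto simp: segre_veronese_exponents_def)
qed

lemma lookup_pos_obtain:
  fixes t :: "'b \<Rightarrow>\<^sub>0 nat"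
  assumes "Poly_Mapping.lookup t x > 0"
  obtains s where "t = s + Poly_Mapping.single x 1"
proof
  show "t = (t - Poly_Mapping.single x 1) + Poly_Mapping.single x 1"
    using assms by (intro poly_mapping_eqI) (auto simp: lookup_add lookup_minus lookup_single when_def)
qed

text \<open>This total degree bounds the weight of a generator, which is a partial sum of
  it.\<close>

lemma sum_lookup_segre_veronese_exponents:
  assumes "g \<in> segre_veronese_exponents k E m"
  shows "(\<Sum>x\<in>(SIGMA i:{1..k}. {1..m i}). Poly_Mapping.lookup g x) = (\<Sum>i = 1..k. E i)"
proof -
  have "(\<Sum>x\<in>(SIGMA i:{1..k}. {1..m i}). Poly_Mapping.lookup g x) =
      (\<Sum>i = 1..k. \<Sum>j = 1..m i. Poly_Mapping.lookup g (i, j))"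
    by (subst sum.Sigma) (auto intro!: sum.cong)
  then show ?thesis using assms by (simp add: segre_veronese_exponents_def)
qed

text \<open>If \<open>h + x\<^sub>j\<close> and \<open>f + x\<^sub>j\<^sub>'\<close> are generators outside \<open>P\<close>, then so are \<open>h + x\<^sub>j\<^sub>'\<close> and
  \<open>f + x\<^sub>j\<close>, which have the same sum; such swaps transform any generator outside \<open>P\<close> into \<open>g\<close>.\<close>

lemma segre_veronese_notin_prime:
  fixes P :: "'a::field xpoly set" and k :: nat and E m :: "nat \<Rightarrow> nat"
  defines "G \<equiv> segre_veronese_exponents k E m"
  assumes "monomial_prime G A P"
    and g: "g \<in> G" "Poly_Mapping.keys g \<subseteq> (\<Union>f\<in>{f \<in> G. monomial f \<notin> P}. Poly_Mapping.keys f)"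
    and h: "h \<in> G" "monomial h \<notin> P"
  shows "monomial g \<notin> P"
  using h
\<comment> \<open>The measure is the total excess of \<open>h\<close> over \<open>g\<close>, with
  truncated differences; each swap lowers it.\<close>
proof (induction "\<Sum>x\<in>(SIGMA i:{1..k}. {1..m i}). Poly_Mapping.lookup h x - Poly_Mapping.lookup g x"
    arbitrary: h rule: less_induct)
  case less
  interpret monomial_prime G A P by fact
  let ?V = "SIGMA i:{1..k}. {1..m i}"
  show ?case
  proof (cases "g = h")
    case False
    then obtain i j j' where ij: "i \<in> {1..k}" "j \<in> {1..m i}" "j' \<in> {1..m i}"
      and hg: "Poly_Mapping.lookup h (i, j') < Poly_Mapping.lookup g (i, j')"
      and gh: "Poly_Mapping.lookup g (i, j) < Poly_Mapping.lookup h (i, j)"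
      using segre_veronese_exponents_ex_less[of h k E m g] g(1) less.prems(1) unfolding G_def by metis
    have "(i, j') \<in> Poly_Mapping.keys g" using hg by (simp add: in_keys_iff)
    \<comment> \<open>The variable \<open>(i, j')\<close> of \<open>g\<close> occurs in some
      generator \<open>f\<close> outside \<open>P\<close>, the partner of the swap.\<close>
    then obtain f where f: "f \<in> G" "monomial f \<notin> P" "Poly_Mapping.lookup f (i, j') > 0"
      using g(2) unfolding in_keys_iff[symmetric] neq0_conv[symmetric] by blast
    obtain f' where f': "f = f' + Poly_Mapping.single (i, j') 1"
      using f(3) by (rule lookup_pos_obtain)
    obtain h' where h': "h = h' + Poly_Mapping.single (i, j) 1"
      using gh by (auto intro: lookup_pos_obtain[of h "(i, j)"])
    define hn fn where "hn = h' + Poly_Mapping.single (i, j') 1"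
      and "fn = f' + Poly_Mapping.single (i, j) 1"
    have G: "hn \<in> G" "fn \<in> G"
      using segre_veronese_exponents_swap less.prems(1) f(1) ij
      unfolding hn_def fn_def h' f' G_def by blast+
    have "hn + fn = h + f" by (simp add: hn_def fn_def h' f' algebra_simps)
    then have notin: "monomial hn \<notin> P"
      using monomial_add_in_P_iff[of hn fn] monomial_add_in_P_iff[of h f]
        f(1,2) less.prems G exponent_monoid_incl by metis
    have "j \<noteq> j'" using gh hg by auto
    \<comment> \<open>At \<open>(i, j')\<close> the exponent in \<open>h\<close> is below that in
      \<open>g\<close>, so raising it by one creates no excess; at \<open>(i, j)\<close> one unit of
      excess disappears.\<close>
    have "(\<Sum>x\<in>?V. Poly_Mapping.lookup hn x - Poly_Mapping.lookup g x) <
        (\<Sum>x\<in>?V. Poly_Mapping.lookup h x - Poly_Mapping.lookup g x)"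
    proof (rule sum_strict_mono_ex1)
      show "\<forall>x\<in>?V. Poly_Mapping.lookup hn x - Poly_Mapping.lookup g x \<le>
          Poly_Mapping.lookup h x - Poly_Mapping.lookup g x"
        using hg \<open>j \<noteq> j'\<close> by (auto simp: hn_def h' lookup_add lookup_single when_def)
      show "\<exists>x\<in>?V. Poly_Mapping.lookup hn x - Poly_Mapping.lookup g x <
          Poly_Mapping.lookup h x - Poly_Mapping.lookup g x"
        using gh ij \<open>j \<noteq> j'\<close>
        by (intro bexI[of _ "(i, j)"]) (auto simp: hn_def h' lookup_add lookup_single when_def)
    qed auto
    from less.hyps[OF this G(1) notin] show ?thesis .
  qed (use less.prems in simp)
qed

theorem theorem4p8:
  fixes k :: nat and E m :: "nat \<Rightarrow> nat"
    and A :: "'a::field xpoly ring" and D r :: nat and P :: "'a xpoly set"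
  assumes "k \<ge> 1"
    and "\<forall>i\<in>{1..k}. E i \<ge> 1"
    and "\<forall>i\<in>{1..k}. m i \<ge> 2"
    and "A = segre_veronese k E m"
    and "D = (\<Sum>i = 1..k. E i)"
    and "r > 0"
    and "primeideal P A"
    and "monomial_ideal P A"
  shows "symbolic_power A P (D * (r - 1) + 1) \<subseteq> ideal_power A P r"
proof -
  define G where "G = segre_veronese_exponents k E m"
  have mp: "monomial_prime G A P"
    using assms by (simp add: monomial_prime_def G_def segre_veronese_eq)
  then interpret monomial_prime G A P .
  define V where "V = (SIGMA i:{1..k}. {1..m i})"
  \<comment> \<open>\<open>T\<close> collects the variables of generators outside \<open>P\<close>,
    so \<open>V - T\<close> is the set \<open>Q\<close> and \<open>w\<close> the degree in
    it.\<close>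
  define T where "T = (\<Union>f\<in>{f \<in> G. monomial f \<notin> P}. Poly_Mapping.keys f)"
  define w where "w t = (\<Sum>x\<in>V - T. Poly_Mapping.lookup t x)" for t :: "nat \<times> nat \<Rightarrow>\<^sub>0 nat"
  have [simp]: "finite V" by (simp add: V_def)
  have V: "Poly_Mapping.keys g \<subseteq> V" if "g \<in> G" for g
    using that by (simp add: G_def segre_veronese_exponents_def V_def)
  have "E 1 \<le> D" unfolding assms(5) by (rule member_le_sum) (use assms(1) in auto)
  with assms(1,2) have D: "D > 0" by (metis atLeastAtMost_iff le_refl less_le_trans zero_less_one)
  have sum: "(\<Sum>x\<in>V. Poly_Mapping.lookup g x) = D" if "g \<in> G" for g
    using that sum_lookup_segre_veronese_exponents by (simp add: V_def G_def assms(5))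
  have "weighted_monomial_prime G A P w D"
  proof
    show "w (s + t) = w s + w t" for s t by (simp add: w_def lookup_add sum.distrib)
    show "w g \<le> D" if "g \<in> G" for g
      unfolding w_def sum[OF that, symmetric] by (intro sum_mono2) auto
    show "w g = 0 \<longleftrightarrow> monomial g \<notin> P" if "g \<in> G" for g
    proof
      assume "monomial g \<notin> P"
      then show "w g = 0" using that by (auto simp: w_def T_def in_keys_iff)
    next
      assume "w g = 0"
      then have keys: "Poly_Mapping.keys g \<subseteq> T" using V[OF that] by (auto simp: w_def in_keys_iff)
      \<comment> \<open>As \<open>D > 0\<close>, \<open>g\<close> involves a variable. It lies in
        \<open>T\<close> and so provides a generator \<open>h\<close> outside \<open>P\<close> from
        which the swaps can start.\<close>
      have "Poly_Mapping.keys g \<noteq> {}" using sum[OF that] D by auto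
      with keys obtain h where "h \<in> G" "monomial h \<notin> P" unfolding T_def by blast
      then show "monomial g \<notin> P"
        using segre_veronese_notin_prime[OF mp[unfolded G_def]] that keys
        unfolding G_def T_def by blast
    qed
  qed (rule D)
  then show ?thesis using assms(6) by (rule weighted_monomial_prime.symbolic_power_subset)
qed

end
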